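(* Let $L(\hat Q,Q)=(\hat Q-Q)^2$ be the squared loss, let $\mathcal{P}=\{P_s(D;Q): s\in S\}$ be a family of distributions for the data $D$ (jointly with the real-valued learning target $Q$ if $Q$ is random), and let $L^2_{\mathcal P}$ be the collection of all real-valued functions of $D$ that are square-integrable with respect to every $P_s$, $s\in S$. Let $$\mathcal{Q}=\{\hat Q(D)\in L^2_{\mathcal P}: \mathrm{E}_s(\hat Q-Q)=0,\ \forall s\in S\}$$ be the collection of unbiased learners of $Q$, and for any $\hat Q\in\mathcal Q$ let $$\mathcal{E}(\hat Q)=\{\hat\delta_{\hat Q}(D)\in L^2_{\mathcal P}: \mathrm{E}_s(\hat\delta_{\hat Q})=0,\ \forall s\in S\}$$ be the collection of unbiased error assessors for the actual error $\delta_{\hat Q}=\hat Q-Q$. Suppose there exists an optimal learner $\hat Q^{\rm opt}\in\mathcal Q$, with risk $R_s^{\rm opt}<\infty$ under $P_s$, $s\in S$. Then: (I) For any $\hat Q\in\mathcal Q$ and any $\hat\delta_{\hat Q}\in\mathcal E(\hat Q)$, $$\rho_s^2(\delta_{\hat Q},\hat\delta_{\hat Q})\le \frac{R_s(\hat Q)-R_s^{\rm opt}}{R_s(\hat Q)}\equiv RR_s(\hat Q),\qquad \forall s\in S,$$ where $RR_s(\hat Q)$ is set to zero if $R_s(\hat Q)=0$. (II) For any particular $s\in S$, the equality $\rho_s^2(\delta_{\hat Q},\hat\delta_{\hat Q})=RR_s(\hat Q)$ holds if and only if $R_s^{\rm opt}$ is attainable in the sub-class $\mathcal Q(\hat Q,\hat\delta_{\hat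 Q})=\{\hat Q-\lambda\hat\delta_{\hat Q}:\lambda\in\mathbb R\}\subset\mathcal Q$, i.e. if and only if there is $\lambda\in\mathbb R$ with $R_s(\hat Q-\lambda\hat\delta_{\hat Q})=R_s^{\rm opt}$.
   Context: The data $D$ take values in a state space $\Omega$. The target $Q$ is real-valued: it may be a function of $s$ (e.g. a model parameter, fixed given $s$) or a random variable (e.g. a future outcome); in the latter case $P_s(D;Q)$ denotes the joint distribution of $D$ and $Q$. A learner $\hat Q:\Omega\to\mathbb R$ and an error assessor $\hat\delta_{\hat Q}:\Omega\to\mathbb R$ are (measurable) functions of the data $D$ only; they do not depend on $s$. $\mathrm{E}_s$, $\mathrm{V}_s$, $\mathrm{Cov}_s$ denote expectation, variance and covariance under $P_s$. The risk of $\hat Q$ is $R_s(\hat Q)=\mathrm{E}_s[L(\hat Q,Q)]=\mathrm{E}_s[(\hat Q-Q)^2]$. An optimal learner is $\hat Q^{\rm opt}\in\mathcal Q$ whose risk $R_s^{\rm opt}=R_s(\hat Q^{\rm opt})$ satisfies $R_s^{\rm opt}\le R_s(\hat Q)$ for all $\hat Q\in\mathcal Q$ and all $s\in S$. $\rho_s(\cdot,\cdot)$ is the (linear) correlation under $P_s$, with the convention that it equals $0$ if either variable has zero variance under $P_s$. *)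

theory Defs
  imports "HOL-Probability.Probability"
begin

text \<open>
  The law \<open>P\<^sub>s(D;Q)\<close> is presented by a probability measure \<open>P s\<close> on a sample space of type
  \<open>'w\<close>, together with the data \<open>D\<close> taking values in the measurable space \<open>\<Omega>\<close> and the real
  target \<open>Q s\<close>.  A target that is a parameter is \<open>Q s = (\<lambda>_. \<theta> s)\<close>; a random target is
  \<open>Q s = Y\<close> for a fixed random variable \<open>Y\<close>.  Learners and assessors are functions on the
  data space, hence depend neither on \<open>s\<close> nor on \<open>Q\<close>.
\<close>

definition learning_family ::
  "'s set \<Rightarrow> ('s \<Rightarrow> 'w measure) \<Rightarrow> 'd measure \<Rightarrow> ('w \<Rightarrow> 'd) \<Rightarrow> ('s \<Rightarrow> 'w \<Rightarrow> real) \<Rightarrow> bool" where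
  "learning_family S P \<Omega> D Q \<longleftrightarrow>
     (\<forall>s\<in>S. prob_space (P s) \<and> D \<in> measurable (P s) \<Omega> \<and> Q s \<in> borel_measurable (P s))"

definition L2_family ::
  "'s set \<Rightarrow> ('s \<Rightarrow> 'w measure) \<Rightarrow> 'd measure \<Rightarrow> ('w \<Rightarrow> 'd) \<Rightarrow> ('d \<Rightarrow> real) set" where
  "L2_family S P \<Omega> D =
     {f \<in> borel_measurable \<Omega>. \<forall>s\<in>S. integrable (P s) (\<lambda>\<omega>. (f (D \<omega>))\<^sup>2)}"

definition actual_error ::
  "('w \<Rightarrow> 'd) \<Rightarrow> ('s \<Rightarrow> 'w \<Rightarrow> real) \<Rightarrow> 's \<Rightarrow> ('d \<Rightarrow> real) \<Rightarrow> 'w \<Rightarrow> real" where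
  "actual_error D Q s q = (\<lambda>\<omega>. q (D \<omega>) - Q s \<omega>)"

text \<open>
  \<open>has_bochner_integral\<close> is used for the zero-mean conditions because the Bochner integral of a
  non-integrable function is \<open>0\<close> by convention.
\<close>

definition unbiased_learners ::
  "'s set \<Rightarrow> ('s \<Rightarrow> 'w measure) \<Rightarrow> 'd measure \<Rightarrow> ('w \<Rightarrow> 'd) \<Rightarrow> ('s \<Rightarrow> 'w \<Rightarrow> real)
    \<Rightarrow> ('d \<Rightarrow> real) set" where
  "unbiased_learners S P \<Omega> D Q =
     {q \<in> L2_family S P \<Omega> D. \<forall>s\<in>S. has_bochner_integral (P s) (actual_error D Q s q) 0}"

text \<open>The defining condition of an unbiased assessor of \<open>q\<close> does not involve \<open>q\<close> itself.\<close>

definition unbiased_assessors ::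
  "'s set \<Rightarrow> ('s \<Rightarrow> 'w measure) \<Rightarrow> 'd measure \<Rightarrow> ('w \<Rightarrow> 'd) \<Rightarrow> ('d \<Rightarrow> real) set" where
  "unbiased_assessors S P \<Omega> D =
     {d \<in> L2_family S P \<Omega> D. \<forall>s\<in>S. has_bochner_integral (P s) (\<lambda>\<omega>. d (D \<omega>)) 0}"

definition squared_loss :: "real \<Rightarrow> real \<Rightarrow> real" where
  "squared_loss x y = (x - y)\<^sup>2"

text \<open>The risk takes values in \<open>ennreal\<close>, so that its finiteness is a genuine condition.\<close>

definition risk ::
  "('s \<Rightarrow> 'w measure) \<Rightarrow> ('w \<Rightarrow> 'd) \<Rightarrow> ('s \<Rightarrow> 'w \<Rightarrow> real) \<Rightarrow> 's \<Rightarrow> ('d \<Rightarrow> real) \<Rightarrow> ennreal" where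
  "risk P D Q s q = (\<integral>\<^sup>+\<omega>. ennreal (squared_loss (q (D \<omega>)) (Q s \<omega>)) \<partial>P s)"

definition optimal_learner ::
  "'s set \<Rightarrow> ('s \<Rightarrow> 'w measure) \<Rightarrow> 'd measure \<Rightarrow> ('w \<Rightarrow> 'd) \<Rightarrow> ('s \<Rightarrow> 'w \<Rightarrow> real)
    \<Rightarrow> ('d \<Rightarrow> real) \<Rightarrow> bool" where
  "optimal_learner S P \<Omega> D Q q_opt \<longleftrightarrow>
     q_opt \<in> unbiased_learners S P \<Omega> D Q \<and>
     (\<forall>q\<in>unbiased_learners S P \<Omega> D Q. \<forall>s\<in>S. risk P D Q s q_opt \<le> risk P D Q s q)"

definition relative_regret ::
  "('s \<Rightarrow> 'w measure) \<Rightarrow> ('w \<Rightarrow> 'd) \<Rightarrow> ('s \<Rightarrow> 'w \<Rightarrow> real) \<Rightarrow> ('d \<Rightarrow> real) \<Rightarrow> 's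
    \<Rightarrow> ('d \<Rightarrow> real) \<Rightarrow> real" where
  "relative_regret P D Q q_opt s q =
     (if risk P D Q s q = 0 then 0
      else (enn2real (risk P D Q s q) - enn2real (risk P D Q s q_opt))
             / enn2real (risk P D Q s q))"

definition covariance :: "'w measure \<Rightarrow> ('w \<Rightarrow> real) \<Rightarrow> ('w \<Rightarrow> real) \<Rightarrow> real" where
  "covariance M X Y =
     (\<integral>\<omega>. (X \<omega> - (\<integral>v. X v \<partial>M)) * (Y \<omega> - (\<integral>v. Y v \<partial>M)) \<partial>M)"

definition correlation :: "'w measure \<Rightarrow> ('w \<Rightarrow> real) \<Rightarrow> ('w \<Rightarrow> real) \<Rightarrow> real" where
  "correlation M X Y =
     (if prob_space.variance M X = 0 \<or> prob_space.variance M Y = 0 then 0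
      else covariance M X Y / sqrt (prob_space.variance M X * prob_space.variance M Y))"

definition learner_subclass :: "('d \<Rightarrow> real) \<Rightarrow> ('d \<Rightarrow> real) \<Rightarrow> ('d \<Rightarrow> real) set" where
  "learner_subclass q d = {(\<lambda>x. q x - c * d x) | c. c \<in> (UNIV :: real set)}"

end

theory Submission
  imports Defs
begin

text \<open>
  Fix \<open>s\<close> and write \<open>R\<close>, \<open>C\<close>, \<open>V\<close> for the expectations of \<open>\<delta>\<^sup>2\<close>, \<open>\<delta> d\<close> and \<open>d\<^sup>2\<close>, where \<open>\<delta>\<close> is
  the actual error of \<open>q\<close> and \<open>d\<close> the assessor. Every \<open>q - \<lambda> d\<close> is again an unbiased learner, with
  risk \<open>R - 2 \<lambda> C + \<lambda>\<^sup>2 V\<close>, so this quadratic in \<open>\<lambda>\<close> stays above the optimal risk. Its minimum is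
  \<open>R - C\<^sup>2 / V = R (1 - \<rho>\<^sup>2)\<close>, which gives the bound, and the bound is tight exactly when
  the minimum equals the optimal risk.
\<close>

lemma integrable_mult_of_square_integrable:
  fixes X Y :: "'a \<Rightarrow> real"
  assumes [measurable]: "X \<in> borel_measurable M" "Y \<in> borel_measurable M"
    and "integrable M (\<lambda>x. (X x)\<^sup>2)" "integrable M (\<lambda>x. (Y x)\<^sup>2)"
  shows "integrable M (\<lambda>x. X x * Y x)"
proof (rule Bochner_Integration.integrable_bound)
  show "integrable M (\<lambda>x. (X x)\<^sup>2 + (Y x)\<^sup>2)"
    using assms by simp
  have "\<bar>a * b\<bar> \<le> a\<^sup>2 + b\<^sup>2" for a b :: real
  proof -
    have "2 * (\<bar>a\<bar> * \<bar>b\<bar>) \<le> a\<^sup>2 + b\<^sup>2"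
      using sum_squares_bound[of "\<bar>a\<bar>" "\<bar>b\<bar>"] by simp
    moreover have "0 \<le> \<bar>a\<bar> * \<bar>b\<bar>" by simp
    ultimately show ?thesis unfolding abs_mult by linarith
  qed
  then show "AE x in M. norm (X x * Y x) \<le> norm ((X x)\<^sup>2 + (Y x)\<^sup>2)"
    by simp
qed simp

text \<open>Integrability and value come together in \<open>has_bochner_integral\<close>, because
  both are needed: integrability for closure of \<open>L2_family\<close> and for passing from one
  learner's error to another's, the value for the risk along the subclass. The cross term is
  integrable since \<bar>XY\<bar> is dominated by the sum of the squares.\<close>

lemma has_bochner_integral_square_diff_mult:
  fixes X Y :: "'a \<Rightarrow> real" and c :: real
  assumes "X \<in> borel_measurable M" "Y \<in> borel_measurable M"
    and "integrable M (\<lambda>x. (X x)\<^sup>2)" "integrable M (\<lambda>x. (Y x)\<^sup>2)"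
  shows "has_bochner_integral M (\<lambda>x. (X x - c * Y x)\<^sup>2)
           ((\<integral>x. (X x)\<^sup>2 \<partial>M) - 2 * c * (\<integral>x. X x * Y x \<partial>M) + c\<^sup>2 * (\<integral>x. (Y x)\<^sup>2 \<partial>M))"
proof -
  have "integrable M (\<lambda>x. X x * Y x)"
    using assms by (rule integrable_mult_of_square_integrable)
  then have "has_bochner_integral M (\<lambda>x. (X x)\<^sup>2 - 2 * c * (X x * Y x) + c\<^sup>2 * (Y x)\<^sup>2)
           ((\<integral>x. (X x)\<^sup>2 \<partial>M) - 2 * c * (\<integral>x. X x * Y x \<partial>M) + c\<^sup>2 * (\<integral>x. (Y x)\<^sup>2 \<partial>M))"
    using assms(3,4)
    by (intro has_bochner_integral_add has_bochner_integral_diff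
        has_bochner_integral_mult_right has_bochner_integral_integrable)
  moreover have "(\<lambda>x. (X x)\<^sup>2 - 2 * c * (X x * Y x) + c\<^sup>2 * (Y x)\<^sup>2) = (\<lambda>x. (X x - c * Y x)\<^sup>2)"
    by (auto simp: power2_eq_square algebra_simps)
  ultimately show ?thesis by simp
qed

text \<open>The whole inequality reduced to real algebra: the left side will be the squared
  correlation, the right side the relative regret. The value 0 at \<open>V = 0\<close> mirrors the
  convention for the correlation with a constant.\<close>

lemma quadratic_minorant_bound:
  fixes R C V m :: real
  assumes "R > 0" "V \<ge> 0" and minorant: "\<And>c. m \<le> R - 2 * c * C + c\<^sup>2 * V"
  shows "(if V = 0 then 0 else C\<^sup>2 / (R * V)) \<le> (R - m) / R"
    and "(if V = 0 then 0 else C\<^sup>2 / (R * V)) = (R - m) / R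
           \<longleftrightarrow> (\<exists>c. R - 2 * c * C + c\<^sup>2 * V = m)"
proof -
  have "(if V = 0 then 0 else C\<^sup>2 / (R * V)) \<le> (R - m) / R \<and>
    ((if V = 0 then 0 else C\<^sup>2 / (R * V)) = (R - m) / R
           \<longleftrightarrow> (\<exists>c. R - 2 * c * C + c\<^sup>2 * V = m))"
  proof (cases "V = 0")
    case True
    \<comment> \<open>For \<open>V = 0\<close> the quadratic degenerates to a line bounded below, so
      its slope must vanish. The point chosen in the contradiction is where that line takes the
      value \<open>m - 1\<close>.\<close>
    have "C = 0"
    proof (rule ccontr)
      assume "C \<noteq> 0"
      then have "2 * ((R - m + 1) / (2 * C)) * C = R - m + 1"
        by simp
      then show False
        using minorant[of "(R - m + 1) / (2 * C)"] True by simp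
    qed
    then show ?thesis
      using True \<open>R > 0\<close> minorant[of 0] by auto
  next
    case False
    with \<open>V \<ge> 0\<close> have "V > 0" by simp
    \<comment> \<open>Completing the square shows the minimum \<open>R - C\<^sup>2 / V\<close>,
      attained at \<open>c = C / V\<close>. As \<open>m\<close> lies below this minimum, it is a
      value of the quadratic only if it equals the minimum.\<close>
    have square: "R - 2 * c * C + c\<^sup>2 * V = R - C\<^sup>2 / V + V * (c - C / V)\<^sup>2" for c
      using \<open>V > 0\<close> by (simp add: power2_eq_square field_simps)
    have ratio: "C\<^sup>2 / (R * V) = (C\<^sup>2 / V) / R"
      by (simp add: field_simps)
    have min: "m \<le> R - C\<^sup>2 / V"
      using minorant[of "C / V"] square[of "C / V"] by simp
    have "(\<exists>c. R - 2 * c * C + c\<^sup>2 * V = m) \<longleftrightarrow> R - C\<^sup>2 / V = m"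
    proof
      assume "\<exists>c. R - 2 * c * C + c\<^sup>2 * V = m"
      then obtain c where "R - C\<^sup>2 / V + V * (c - C / V)\<^sup>2 = m"
        using square by metis
      moreover have "0 \<le> V * (c - C / V)\<^sup>2"
        using \<open>V > 0\<close> by simp
      ultimately show "R - C\<^sup>2 / V = m"
        using min by linarith
    next
      assume "R - C\<^sup>2 / V = m"
      then show "\<exists>c. R - 2 * c * C + c\<^sup>2 * V = m"
        using square[of "C / V"] by (intro exI[of _ "C / V"]) simp
    qed
    moreover have "C\<^sup>2 / (R * V) \<le> (R - m) / R"
      unfolding ratio using \<open>R > 0\<close> min by (intro divide_right_mono) auto
    moreover have "C\<^sup>2 / (R * V) = (R - m) / R \<longleftrightarrow> R - C\<^sup>2 / V = m"
      unfolding ratio using \<open>R > 0\<close> by (subst divide_cancel_right) auto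
    ultimately show ?thesis
      using False by simp
  qed
  then show "(if V = 0 then 0 else C\<^sup>2 / (R * V)) \<le> (R - m) / R"
    and "(if V = 0 then 0 else C\<^sup>2 / (R * V)) = (R - m) / R
           \<longleftrightarrow> (\<exists>c. R - 2 * c * C + c\<^sup>2 * V = m)"
    by blast+
qed

lemma correlation_square_zero_mean:
  assumes "prob_space M" "(\<integral>x. X x \<partial>M) = 0" "(\<integral>x. Y x \<partial>M) = 0"
  shows "(correlation M X Y)\<^sup>2 =
    (if (\<integral>x. (X x)\<^sup>2 \<partial>M) = 0 \<or> (\<integral>x. (Y x)\<^sup>2 \<partial>M) = 0 then 0
     else (\<integral>x. X x * Y x \<partial>M)\<^sup>2 / ((\<integral>x. (X x)\<^sup>2 \<partial>M) * (\<integral>x. (Y x)\<^sup>2 \<partial>M)))"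
  using assms by (simp add: correlation_def covariance_def power_divide)

lemma L2_family_diff_mult:
  fixes c :: real
  assumes "learning_family S P \<Omega> D Q" "f \<in> L2_family S P \<Omega> D" "g \<in> L2_family S P \<Omega> D"
  shows "(\<lambda>x. f x - c * g x) \<in> L2_family S P \<Omega> D"
proof -
  have [measurable]: "f \<in> borel_measurable \<Omega>" "g \<in> borel_measurable \<Omega>"
    using assms by (auto simp: L2_family_def)
  have "integrable (P s) (\<lambda>\<omega>. (f (D \<omega>) - c * g (D \<omega>))\<^sup>2)" if "s \<in> S" for s
  proof -
    have [measurable]: "D \<in> measurable (P s) \<Omega>"
      using assms that by (auto simp: learning_family_def)
    show ?thesis
      using assms that
      by (intro integrable.intros[OF has_bochner_integral_square_diff_mult])
        (auto simp: L2_family_def)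
  qed
  then show ?thesis
    by (simp add: L2_family_def)
qed

lemma learner_subclass_subset:
  assumes "learning_family S P \<Omega> D Q" "q \<in> unbiased_learners S P \<Omega> D Q"
    "d \<in> unbiased_assessors S P \<Omega> D"
  shows "learner_subclass q d \<subseteq> unbiased_learners S P \<Omega> D Q"
proof -
  have "(\<lambda>x. q x - c * d x) \<in> unbiased_learners S P \<Omega> D Q" for c
  proof -
    have "has_bochner_integral (P s) (actual_error D Q s (\<lambda>x. q x - c * d x)) 0" if "s \<in> S" for s
    proof -
      have "has_bochner_integral (P s) (\<lambda>\<omega>. actual_error D Q s q \<omega> - c * d (D \<omega>)) (0 - c * 0)"
        using assms that
        by (intro has_bochner_integral_diff has_bochner_integral_mult_right)
          (auto simp: unbiased_learners_def unbiased_assessors_def)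
      moreover have "actual_error D Q s (\<lambda>x. q x - c * d x)
          = (\<lambda>\<omega>. actual_error D Q s q \<omega> - c * d (D \<omega>))"
        by (auto simp: actual_error_def)
      ultimately show ?thesis by simp
    qed
    then show ?thesis
      using assms L2_family_diff_mult
      by (fastforce simp: unbiased_learners_def unbiased_assessors_def)
  qed
  then show ?thesis
    by (auto simp: learner_subclass_def)
qed

text \<open>This is the bridge from the \<open>ennreal\<close> risk to Bochner integrals: a
  nonnegative measurable function is Bochner integrable exactly when its nonnegative integral is
  finite.\<close>

lemma integrable_actual_error_square_iff:
  assumes "learning_family S P \<Omega> D Q" "q \<in> L2_family S P \<Omega> D" "s \<in> S"
  shows "integrable (P s) (\<lambda>\<omega>. (actual_error D Q s q \<omega>)\<^sup>2) \<longleftrightarrow> risk P D Q s q < \<infinity>"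
proof -
  have [measurable]: "q \<in> borel_measurable \<Omega>" "D \<in> measurable (P s) \<Omega>"
    "Q s \<in> borel_measurable (P s)"
    using assms by (auto simp: L2_family_def learning_family_def)
  show ?thesis
    by (simp add: integrable_iff_bounded risk_def squared_loss_def actual_error_def)
qed

lemma risk_eq_integral:
  assumes "integrable (P s) (\<lambda>\<omega>. (actual_error D Q s q \<omega>)\<^sup>2)"
  shows "risk P D Q s q = ennreal (\<integral>\<omega>. (actual_error D Q s q \<omega>)\<^sup>2 \<partial>P s)"
  using nn_integral_eq_integral[OF assms]
  by (simp add: risk_def squared_loss_def actual_error_def)

text \<open>The difference of two learners does not involve the target, hence it is square integrable
  even though the target itself need not be.\<close>

lemma integrable_actual_error_square:
  assumes "learning_family S P \<Omega> D Q" "s \<in> S"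
    and "q \<in> L2_family S P \<Omega> D" "q0 \<in> L2_family S P \<Omega> D" "risk P D Q s q0 < \<infinity>"
  shows "integrable (P s) (\<lambda>\<omega>. (actual_error D Q s q \<omega>)\<^sup>2)"
proof -
  have [measurable]: "q \<in> borel_measurable \<Omega>" "q0 \<in> borel_measurable \<Omega>"
    "D \<in> measurable (P s) \<Omega>" "Q s \<in> borel_measurable (P s)"
    using assms by (auto simp: L2_family_def learning_family_def)
  have "integrable (P s) (\<lambda>\<omega>. (q0 (D \<omega>) - 1 * q (D \<omega>))\<^sup>2)"
    using L2_family_diff_mult[OF assms(1) assms(4) assms(3), of 1] \<open>s \<in> S\<close>
    by (auto simp: L2_family_def)
  moreover have "integrable (P s) (\<lambda>\<omega>. (actual_error D Q s q0 \<omega>)\<^sup>2)"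
    using integrable_actual_error_square_iff[OF assms(1,4,2)] assms(5) by simp
  moreover have "actual_error D Q s q0 \<in> borel_measurable (P s)"
    by (simp add: actual_error_def)
  \<comment> \<open>The error of \<open>q\<close> is the error of \<open>q0\<close> minus
    \<open>q0 - q\<close>. The factors \<open>1\<close> only give the differences the shape
    \<open>X - c * Y\<close> of the expansion lemma.\<close>
  ultimately have "integrable (P s)
      (\<lambda>\<omega>. (actual_error D Q s q0 \<omega> - 1 * (q0 (D \<omega>) - 1 * q (D \<omega>)))\<^sup>2)"
    by - (rule integrable.intros[OF has_bochner_integral_square_diff_mult]; simp)
  then show ?thesis
    by (simp add: actual_error_def)
qed

lemma correlation_square_relative_regret:
  assumes family: "learning_family S P \<Omega> D Q"
    and opt: "optimal_learner S P \<Omega> D Q q_opt"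
    and finite_risk: "risk P D Q s q_opt < \<infinity>"
    and q: "q \<in> unbiased_learners S P \<Omega> D Q" and d: "d \<in> unbiased_assessors S P \<Omega> D"
    and s: "s \<in> S"
  shows "(correlation (P s) (actual_error D Q s q) (\<lambda>\<omega>. d (D \<omega>)))\<^sup>2
           \<le> relative_regret P D Q q_opt s q"
    and "(correlation (P s) (actual_error D Q s q) (\<lambda>\<omega>. d (D \<omega>)))\<^sup>2
           = relative_regret P D Q q_opt s q
         \<longleftrightarrow> (\<exists>q'\<in>learner_subclass q d. risk P D Q s q' = risk P D Q s q_opt)"
proof -
  let ?e = "actual_error D Q s q" and ?a = "\<lambda>\<omega>. d (D \<omega>)"
  define R where "R = (\<integral>\<omega>. (?e \<omega>)\<^sup>2 \<partial>P s)"
  define C where "C = (\<integral>\<omega>. ?e \<omega> * ?a \<omega> \<partial>P s)"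
  define V where "V = (\<integral>\<omega>. (?a \<omega>)\<^sup>2 \<partial>P s)"
  define m where "m = enn2real (risk P D Q s q_opt)"
  have q_opt: "q_opt \<in> unbiased_learners S P \<Omega> D Q"
    using opt by (simp add: optimal_learner_def)
  have L2: "q \<in> L2_family S P \<Omega> D" "q_opt \<in> L2_family S P \<Omega> D" "d \<in> L2_family S P \<Omega> D"
    using q q_opt d by (auto simp: unbiased_learners_def unbiased_assessors_def)
  have [measurable]: "q \<in> borel_measurable \<Omega>" "d \<in> borel_measurable \<Omega>"
    "D \<in> measurable (P s) \<Omega>" "Q s \<in> borel_measurable (P s)"
    using L2 family s by (auto simp: L2_family_def learning_family_def)
  have meas: "?e \<in> borel_measurable (P s)" "?a \<in> borel_measurable (P s)"
    by (simp_all add: actual_error_def)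
  \<comment> \<open>Finite optimal risk forces finite risk of \<open>q\<close>, so \<open>R\<close>
    is a genuine second moment and not the default 0 of a divergent integral.\<close>
  have int: "integrable (P s) (\<lambda>\<omega>. (?e \<omega>)\<^sup>2)" "integrable (P s) (\<lambda>\<omega>. (?a \<omega>)\<^sup>2)"
    using integrable_actual_error_square[OF family s L2(1,2) finite_risk] L2 s
    by (auto simp: L2_family_def)
  have nonneg: "R \<ge> 0" "V \<ge> 0" "m \<ge> 0"
    by (auto simp: R_def V_def m_def)
  have opt_risk: "risk P D Q s q_opt = ennreal m"
    using finite_risk by (simp add: m_def)
  have risk_q: "risk P D Q s q = ennreal R"
    unfolding R_def by (rule risk_eq_integral[of P s D Q q, OF int(1)])
  \<comment> \<open>Nonnegativity is recorded as well because \<open>ennreal\<close> sends negative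
    reals to 0; with it, comparisons and equalities of risks can be read back in the reals.\<close>
  have sub_risk: "risk P D Q s (\<lambda>x. q x - c * d x) = ennreal (R - 2 * c * C + c\<^sup>2 * V)"
    and sub_nonneg: "0 \<le> R - 2 * c * C + c\<^sup>2 * V" for c
  proof -
    have eq: "actual_error D Q s (\<lambda>x. q x - c * d x) = (\<lambda>\<omega>. ?e \<omega> - c * ?a \<omega>)"
      by (auto simp: actual_error_def)
    have "has_bochner_integral (P s) (\<lambda>\<omega>. (actual_error D Q s (\<lambda>x. q x - c * d x) \<omega>)\<^sup>2)
        (R - 2 * c * C + c\<^sup>2 * V)"
      unfolding eq R_def C_def V_def
      by (rule has_bochner_integral_square_diff_mult[OF meas int])
    note int_sub = this[unfolded has_bochner_integral_iff]
    then show "risk P D Q s (\<lambda>x. q x - c * d x) = ennreal (R - 2 * c * C + c\<^sup>2 * V)"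
      using risk_eq_integral[of P s D Q "\<lambda>x. q x - c * d x"] by simp
    show "0 \<le> R - 2 * c * C + c\<^sup>2 * V"
      unfolding conjunct2[OF int_sub, symmetric] by simp
  qed
  \<comment> \<open>Optimality enters here: each \<open>q - c * d\<close> is an unbiased competitor
    of \<open>q_opt\<close>.\<close>
  have minorant: "m \<le> R - 2 * c * C + c\<^sup>2 * V" for c
  proof -
    have "(\<lambda>x. q x - c * d x) \<in> unbiased_learners S P \<Omega> D Q"
      using learner_subclass_subset[OF family q d] by (auto simp: learner_subclass_def)
    then have "risk P D Q s q_opt \<le> risk P D Q s (\<lambda>x. q x - c * d x)"
      using opt s by (simp add: optimal_learner_def)
    then show ?thesis
      using sub_nonneg[of c] by (simp add: opt_risk sub_risk ennreal_le_iff)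
  qed
  have attain: "(\<exists>q'\<in>learner_subclass q d. risk P D Q s q' = risk P D Q s q_opt)
      \<longleftrightarrow> (\<exists>c. R - 2 * c * C + c\<^sup>2 * V = m)"
    using sub_nonneg nonneg by (auto simp: learner_subclass_def opt_risk sub_risk ennreal_inj)
  have "prob_space (P s)" "has_bochner_integral (P s) ?e 0" "has_bochner_integral (P s) ?a 0"
    using family q d s
    by (auto simp: learning_family_def unbiased_learners_def unbiased_assessors_def)
  then have corr: "(correlation (P s) ?e ?a)\<^sup>2 = (if R = 0 \<or> V = 0 then 0 else C\<^sup>2 / (R * V))"
    unfolding R_def C_def V_def
    by (intro correlation_square_zero_mean has_bochner_integral_integral_eq)
  have regret: "relative_regret P D Q q_opt s q = (if R = 0 then 0 else (R - m) / R)"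
    using nonneg by (simp add: relative_regret_def risk_q opt_risk)
  have "(correlation (P s) ?e ?a)\<^sup>2 \<le> relative_regret P D Q q_opt s q \<and>
    ((correlation (P s) ?e ?a)\<^sup>2 = relative_regret P D Q q_opt s q
      \<longleftrightarrow> (\<exists>c. R - 2 * c * C + c\<^sup>2 * V = m))"
  proof (cases "R = 0")
    \<comment> \<open>If \<open>R = 0\<close>, correlation and regret are both 0 by convention, so
      attainment has to be automatic: the minorant at \<open>c = 0\<close> gives
      \<open>m \<le> 0\<close>, hence \<open>m = 0\<close>, and \<open>q\<close> itself attains the
      optimal risk.\<close>
    case True
    then have "\<exists>c. R - 2 * c * C + c\<^sup>2 * V = m"
      using minorant[of 0] nonneg by (intro exI[of _ 0]) simp
    then show ?thesis
      using True by (simp add: corr regret)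
  next
    case False
    then show ?thesis
      using quadratic_minorant_bound[of R V m C] nonneg minorant
      by (simp add: corr regret)
  qed
  then show "(correlation (P s) ?e ?a)\<^sup>2 \<le> relative_regret P D Q q_opt s q"
    and "(correlation (P s) ?e ?a)\<^sup>2 = relative_regret P D Q q_opt s q
         \<longleftrightarrow> (\<exists>q'\<in>learner_subclass q d. risk P D Q s q' = risk P D Q s q_opt)"
    unfolding attain by blast+
qed

theorem theorem1:
  fixes S :: "'s set" and P :: "'s \<Rightarrow> 'w measure" and \<Omega> :: "'d measure"
    and D :: "'w \<Rightarrow> 'd" and Q :: "'s \<Rightarrow> 'w \<Rightarrow> real" and q_opt :: "'d \<Rightarrow> real"
  assumes family: "learning_family S P \<Omega> D Q"
    and opt: "optimal_learner S P \<Omega> D Q q_opt"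
    and finite_risk: "\<forall>s\<in>S. risk P D Q s q_opt < \<infinity>"
  shows "(\<forall>q\<in>unbiased_learners S P \<Omega> D Q. \<forall>d\<in>unbiased_assessors S P \<Omega> D. \<forall>s\<in>S.
            (correlation (P s) (actual_error D Q s q) (\<lambda>\<omega>. d (D \<omega>)))\<^sup>2
              \<le> relative_regret P D Q q_opt s q) \<and>
         (\<forall>q\<in>unbiased_learners S P \<Omega> D Q. \<forall>d\<in>unbiased_assessors S P \<Omega> D.
            learner_subclass q d \<subseteq> unbiased_learners S P \<Omega> D Q \<and>
            (\<forall>s\<in>S. (correlation (P s) (actual_error D Q s q) (\<lambda>\<omega>. d (D \<omega>)))\<^sup>2
                      = relative_regret P D Q q_opt s q
                    \<longleftrightarrow> (\<exists>q'\<in>learner_subclass q d. risk P D Q s q' = risk P D Q s q_opt)))"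
  using correlation_square_relative_regret[OF family opt] learner_subclass_subset[OF family]
    finite_risk
  by meson

end
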